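(* Let $\mathbf q=(q_{ij})$ be an $N\times M$ matrix with non-negative entries such that every row and every column contains at least one strictly positive entry. Let $f_1,\dots,f_M$ and $g_1,\dots,g_N$ be bijections from $R_+$ to $R_+$, where $R_+=(0,\infty)$, and let $a_{ij},b_{ij}\ge 0$ $(i=1,\dots,N,\ j=1,\dots,M)$ be weights. Consider the system of $M+N$ equations in the unknowns $PPP_1,\dots,PPP_M$ and $P_1,\dots,P_N$: $$f_j(PPP_j)=\sum_{n=1}^{N}a_{nj}\,g_n(P_n)\quad (j=1,\dots,M),\qquad g_i(P_i)=\sum_{m=1}^{M}b_{im}\,f_m(PPP_m)\quad (i=1,\dots,N).$$ Assume that there are non-negative numbers $c_{ij},d_{ij}$ such that for all $i,j$ $$a_{ij}=\frac{d_{ij}}{\sum_{n=1}^{N}c_{nj}},\qquad b_{ij}=\frac{c_{ij}}{\sum_{m=1}^{M}d_{im}},\qquad q_{ij}>0\Leftrightarrow d_{ij}>0,\qquad q_{ij}>0\Leftrightarrow c_{ij}>0 .$$ Then the system has a positive solution that is unique up to a positive scalar factor if and only if the matrix $\mathbf q$ is connected.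
   Context: Connectedness of $\mathbf q$: a non-negative $N\times M$ matrix $\mathbf q$ is connected if for every nonempty proper subset $J\subset\{1,\dots,M\}$ there exist $j\in J$, $l\in\{1,\dots,M\}\setminus J$ and $k\in\{1,\dots,N\}$ such that $q_{kj}>0$ and $q_{kl}>0$. "Unique up to a positive scalar factor" refers to the values $f_j(PPP_j)$, $g_i(P_i)$: a positive solution exists, and for any two positive solutions $(PPP_j,P_i)$ and $(PPP'_j,P'_i)$ there is $\delta>0$ with $f_j(PPP'_j)=\delta f_j(PPP_j)$ for all $j$ and $g_i(P'_i)=\delta g_i(P_i)$ for all $i$. *)

theory Defs
  imports "HOL-Analysis.Analysis"
begin

text \<open>An \<open>N \<times> M\<close> matrix is a value of type \<open>real ^ 'm ^ 'n\<close> with \<open>N = CARD('n)\<close> rows and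
  \<open>M = CARD('m)\<close> columns.\<close>

definition nonneg_matrix :: "real ^ 'm ^ 'n \<Rightarrow> bool" where
  "nonneg_matrix A \<longleftrightarrow> (\<forall>i j. A $ i $ j \<ge> 0)"

definition connected_matrix :: "real ^ 'm ^ 'n \<Rightarrow> bool" where
  "connected_matrix q \<longleftrightarrow>
     (\<forall>J. J \<noteq> {} \<and> J \<subset> UNIV \<longrightarrow> (\<exists>j\<in>J. \<exists>l\<in>UNIV - J. \<exists>k. q $ k $ j > 0 \<and> q $ k $ l > 0))"

definition positive_solution ::
  "('m \<Rightarrow> real \<Rightarrow> real) \<Rightarrow> ('n \<Rightarrow> real \<Rightarrow> real) \<Rightarrow> real ^ 'm ^ 'n \<Rightarrow> real ^ 'm ^ 'n
     \<Rightarrow> real ^ 'm \<Rightarrow> real ^ 'n \<Rightarrow> bool" where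
  "positive_solution f g a b PPP P \<longleftrightarrow>
     (\<forall>j. PPP $ j > 0) \<and> (\<forall>i. P $ i > 0) \<and>
     (\<forall>j. f j (PPP $ j) = (\<Sum>n\<in>UNIV. a $ n $ j * g n (P $ n))) \<and>
     (\<forall>i. g i (P $ i) = (\<Sum>m\<in>UNIV. b $ i $ m * f m (PPP $ m)))"

text \<open>The scalar acts on the values \<open>f j (PPP $ j)\<close> and \<open>g i (P $ i)\<close>, not on the unknowns
  themselves.\<close>

definition unique_positive_solution_up_to_scalar ::
  "('m \<Rightarrow> real \<Rightarrow> real) \<Rightarrow> ('n \<Rightarrow> real \<Rightarrow> real) \<Rightarrow> real ^ 'm ^ 'n \<Rightarrow> real ^ 'm ^ 'n \<Rightarrow> bool" where
  "unique_positive_solution_up_to_scalar f g a b \<longleftrightarrow>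
     (\<exists>PPP P. positive_solution f g a b PPP P) \<and>
     (\<forall>PPP P PPP' P'. positive_solution f g a b PPP P \<and> positive_solution f g a b PPP' P' \<longrightarrow>
        (\<exists>\<delta>>0. (\<forall>j. f j (PPP' $ j) = \<delta> * f j (PPP $ j)) \<and> (\<forall>i. g i (P' $ i) = \<delta> * g i (P $ i))))"

end

theory Submission
  imports Defs
begin

text \<open>With \<open>x j = f j (PPP $ j)\<close> and \<open>y i = g i (P $ i)\<close> the system reads
  \<open>x = a\<^sup>T y\<close>, \<open>y = b x\<close>, so
  the solutions correspond to the positive fixed vectors of \<open>L = a\<^sup>T b\<close>. The column sums
  of \<open>c\<close> form a positive left fixed vector of \<open>L\<close>. Hence \<open>1\<close> is an eigenvalue, and passing to
  absolute values in an eigenvector yields a nonnegative one. If \<open>q\<close> is connected then \<open>L\<close> is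
  irreducible, so the zero set of a nonnegative fixed vector is empty or everything; this
  gives positivity, and, applied to \<open>z - \<delta> x\<close> with the smallest ratio \<open>\<delta>\<close>, uniqueness.
  If \<open>q\<close> is not connected, any solution can be rescaled on one block alone.\<close>

text \<open>The cut form of irreducibility: in the digraph of positive entries an edge leaves every
  nonempty proper set of indices. It has the shape of \<open>connected_matrix\<close>, with the
  linking row \<open>k\<close> absorbed into the product matrix.\<close>

definition irreducible_matrix :: "real ^ 'm ^ 'm \<Rightarrow> bool" where
  "irreducible_matrix L \<longleftrightarrow>
     (\<forall>J. J \<noteq> {} \<and> J \<subset> UNIV \<longrightarrow> (\<exists>j\<in>J. \<exists>l\<in>UNIV - J. L $ j $ l > 0))"

text \<open>Zeros spread along positive entries: at an index where \<open>x\<close> vanishes the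
  fixed-point equation writes 0 as a sum of nonnegative terms, so each term is 0. Irreducibility
  provides a positive entry leading out of the zero set.\<close>

lemma irreducible_fixed_vector_eq_0:
  fixes L :: "real ^ 'm ^ 'm"
  assumes L: "nonneg_matrix L" "irreducible_matrix L"
    and x: "\<And>j. x $ j \<ge> 0" "L *v x = x" and j: "x $ j = 0"
  shows "x = 0"
proof (rule ccontr)
  assume "x \<noteq> 0"
  let ?J = "{j. x $ j = 0}"
  have "?J \<noteq> {} \<and> ?J \<subset> UNIV"
    using j \<open>x \<noteq> 0\<close> by (auto simp: vec_eq_iff)
  from L(2)[unfolded irreducible_matrix_def, rule_format, OF this]
  obtain i l where i: "x $ i = 0" and l: "x $ l \<noteq> 0" and pos: "L $ i $ l > 0"
    by auto
  have "(\<Sum>m\<in>UNIV. L $ i $ m * x $ m) = 0"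
    using arg_cong[OF x(2), of "\<lambda>v. v $ i"] i by (simp add: matrix_vector_mult_def)
  moreover have "L $ i $ m * x $ m \<ge> 0" for m
    using L(1) x(1) by (simp add: nonneg_matrix_def)
  ultimately have "L $ i $ l * x $ l = 0"
    by (simp add: sum_nonneg_eq_0_iff)
  with pos l show False by simp
qed

text \<open>A case of the Perron-Frobenius theorem. The left vector \<open>w\<close> is used twice:
  it makes 1 an eigenvalue, and it forces equality in the triangle inequality.\<close>

lemma irreducible_positive_fixed_vector:
  fixes L :: "real ^ 'm ^ 'm"
  assumes L: "nonneg_matrix L" "irreducible_matrix L"
    and w: "\<And>j. w $ j > 0" "w v* L = w"
  obtains x where "\<And>j. x $ j > 0" "L *v x = x"
proof -
  have "w \<noteq> 0"
    using w(1)[of undefined] by auto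
  \<comment> \<open>A matrix and its transpose have the same rank, so a left kernel vector of
    \<open>L - mat 1\<close> yields a right one, \<open>u\<close>, of unknown signs.\<close>
  moreover have "transpose (L - mat 1) *v w = 0"
    using w(2) by (simp add: vector_matrix_mult_diff_rdistrib)
  ultimately obtain u where u: "u \<noteq> 0" "(L - mat 1) *v u = 0"
    by (metis matrix_nonfull_linear_equations_eq rank_transpose)
  then have Lu: "L *v u = u"
    by (simp add: matrix_vector_mult_diff_rdistrib)
  define x where "x = (\<chi> j. \<bar>u $ j\<bar>)"
  have le: "x $ j \<le> (L *v x) $ j" for j
  proof -
    have "x $ j = \<bar>\<Sum>m\<in>UNIV. L $ j $ m * u $ m\<bar>"
      using arg_cong[OF Lu, of "\<lambda>v. v $ j"] by (simp add: x_def matrix_vector_mult_def)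
    also have "\<dots> \<le> (\<Sum>m\<in>UNIV. \<bar>L $ j $ m * u $ m\<bar>)"
      by (rule sum_abs)
    also have "\<dots> = (L *v x) $ j"
      using L(1) by (simp add: matrix_vector_mult_def x_def nonneg_matrix_def abs_mult)
    finally show ?thesis .
  qed
  \<comment> \<open>The excess of \<open>L *v x\<close> over \<open>x\<close> is nonnegative in each
    coordinate and has total weight 0 under the positive weights \<open>w\<close>, so it
    vanishes.\<close>
  have "w \<bullet> (L *v x) = w \<bullet> x"
    by (metis dot_lmul_matrix w(2))
  then have "(\<Sum>j\<in>UNIV. w $ j * ((L *v x) $ j - x $ j)) = 0"
    by (simp add: inner_vec_def right_diff_distrib sum_subtractf)
  moreover have "w $ j * ((L *v x) $ j - x $ j) \<ge> 0" for j
    using le w(1)[of j] by simp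
  ultimately have "w $ j * ((L *v x) $ j - x $ j) = 0" for j
    by (simp add: sum_nonneg_eq_0_iff)
  then have fixed: "L *v x = x"
    using w(1) less_imp_neq by (fastforce simp: vec_eq_iff)
  have "x $ j > 0" for j
  proof (rule ccontr)
    assume "\<not> x $ j > 0"
    then have "x $ j = 0" by (simp add: x_def)
    with irreducible_fixed_vector_eq_0[OF L _ fixed] have "x = 0"
      by (simp add: x_def)
    with u(1) show False by (simp add: x_def vec_eq_iff)
  qed
  with fixed show thesis using that by blast
qed

lemma irreducible_fixed_vector_unique:
  fixes L :: "real ^ 'm ^ 'm"
  assumes L: "nonneg_matrix L" "irreducible_matrix L"
    and x: "\<And>j. x $ j > 0" "L *v x = x" and z: "\<And>j. z $ j > 0" "L *v z = z"
  obtains \<delta> where "\<delta> > 0" "z = \<delta> *\<^sub>R x"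
proof -
  \<comment> \<open>The largest factor for which \<open>z - \<delta> *\<^sub>R x\<close> stays
    nonnegative; an index attaining the minimum makes one coordinate 0.\<close>
  define \<delta> where "\<delta> = Min (range (\<lambda>j. z $ j / x $ j))"
  have "\<delta> \<in> range (\<lambda>j. z $ j / x $ j)"
    unfolding \<delta>_def by (rule Min_in) auto
  then obtain j where j: "\<delta> = z $ j / x $ j" by auto
  have "\<delta> * x $ m \<le> z $ m" for m
  proof -
    have "\<delta> \<le> z $ m / x $ m" by (simp add: \<delta>_def)
    with x(1)[of m] show ?thesis by (simp add: pos_le_divide_eq)
  qed
  then have "(z - \<delta> *\<^sub>R x) $ m \<ge> 0" for m
    by simp
  moreover have "L *v (z - \<delta> *\<^sub>R x) = z - \<delta> *\<^sub>R x"
    using x(2) z(2) by (simp add: matrix_vector_mult_diff_distrib matrix_vector_mult_scaleR)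
  moreover have "(z - \<delta> *\<^sub>R x) $ j = 0"
    using x(1)[of j] j by simp
  ultimately have "z - \<delta> *\<^sub>R x = 0"
    using irreducible_fixed_vector_eq_0[OF L] by blast
  moreover have "\<delta> > 0"
    using j x(1) z(1) by simp
  ultimately show thesis using that by simp
qed

lemma positive_solution_iff:
  fixes a b :: "real ^ 'm ^ 'n"
  shows "positive_solution f g a b PPP P \<longleftrightarrow>
    (\<forall>j. PPP $ j > 0) \<and> (\<forall>i. P $ i > 0) \<and>
    (\<chi> j. f j (PPP $ j)) = (\<chi> i. g i (P $ i)) v* a \<and>
    (\<chi> i. g i (P $ i)) = b *v (\<chi> j. f j (PPP $ j))"
  by (simp add: positive_solution_def vec_eq_iff matrix_vector_mult_def vector_matrix_mult_def
      mult.commute)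

lemma positive_solution_vector_form:
  assumes "positive_solution f g a b PPP P"
  shows "(\<chi> j. f j (PPP $ j)) = (\<chi> i. g i (P $ i)) v* a"
    and "(\<chi> i. g i (P $ i)) = b *v (\<chi> j. f j (PPP $ j))"
  using assms unfolding positive_solution_iff by blast+

lemma positive_solution_pos:
  assumes "positive_solution f g a b PPP P"
    and "\<forall>j. bij_betw (f j) {0<..} {0<..}" "\<forall>i. bij_betw (g i) {0<..} {0<..}"
  shows "f j (PPP $ j) > 0" "g i (P $ i) > 0"
  using assms bij_betw_apply[of "f j"] bij_betw_apply[of "g i"]
  unfolding positive_solution_iff greaterThan_iff by blast+

text \<open>Surjectivity of each \<open>f j\<close> and \<open>g i\<close> onto the positive reals
  gives preimages coordinate by coordinate, so solving the system amounts to solving a linear one in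
  positive vectors.\<close>

lemma positive_solution_of_vectors:
  fixes a b :: "real ^ 'm ^ 'n"
  assumes f: "\<forall>j. bij_betw (f j) {0<..} {0<..}" and g: "\<forall>i. bij_betw (g i) {0<..} {0<..}"
    and pos: "\<And>j. x $ j > 0" "\<And>i. y $ i > 0"
    and eqs: "x = y v* a" "y = b *v x"
  obtains PPP P where "positive_solution f g a b PPP P"
    "\<And>j. f j (PPP $ j) = x $ j" "\<And>i. g i (P $ i) = y $ i"
proof -
  have "\<exists>p>0. f j p = x $ j" for j
    using f pos(1) by (metis bij_betw_imp_surj_on greaterThan_iff imageE)
  then obtain p where p: "\<And>j. p j > 0" "\<And>j. f j (p j) = x $ j" by metis
  have "\<exists>r>0. g i r = y $ i" for i
    using g pos(2) by (metis bij_betw_imp_surj_on greaterThan_iff imageE)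
  then obtain r where r: "\<And>i. r i > 0" "\<And>i. g i (r i) = y $ i" by metis
  have xy: "(\<chi> j. f j ((\<chi> j. p j) $ j)) = x" "(\<chi> i. g i ((\<chi> i. r i) $ i)) = y"
    using p(2) r(2) by (simp_all add: vec_eq_iff)
  have "positive_solution f g a b (\<chi> j. p j) (\<chi> i. r i)"
    unfolding positive_solution_iff xy by (intro conjI allI eqs) (simp_all add: p(1) r(1))
  then show thesis using that p r by simp
qed

lemma unique_positive_solution_imp_connected:
  fixes q a b :: "real ^ 'm ^ 'n"
  assumes f: "\<forall>j. bij_betw (f j) {0<..} {0<..}" and g: "\<forall>i. bij_betw (g i) {0<..} {0<..}"
    and supp: "\<And>i j. a $ i $ j \<noteq> 0 \<Longrightarrow> q $ i $ j > 0" "\<And>i j. b $ i $ j \<noteq> 0 \<Longrightarrow> q $ i $ j > 0"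
    and uniq: "unique_positive_solution_up_to_scalar f g a b"
  shows "connected_matrix q"
proof (rule ccontr)
  assume "\<not> connected_matrix q"
  then obtain J where J: "J \<noteq> {}" "J \<subset> UNIV"
    and no_link: "\<not> (\<exists>j\<in>J. \<exists>l\<in>UNIV - J. \<exists>k. q $ k $ j > 0 \<and> q $ k $ l > 0)"
    unfolding connected_matrix_def by meson
  have sep: "\<not> q $ k $ l > 0" if "j \<in> J" "l \<notin> J" "q $ k $ j > 0" for j l k
    using no_link that by blast
  from uniq obtain PPP P where sol: "positive_solution f g a b PPP P"
    unfolding unique_positive_solution_up_to_scalar_def by blast
  then have sol_eq: "\<And>j. f j (PPP $ j) = (\<Sum>n\<in>UNIV. a $ n $ j * g n (P $ n))"
    "\<And>i. g i (P $ i) = (\<Sum>m\<in>UNIV. b $ i $ m * f m (PPP $ m))"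
    unfolding positive_solution_def by blast+
  define s where "s j = (if j \<in> J then 2 else 1 :: real)" for j
  \<comment> \<open>A row takes the factor of the columns in which \<open>q\<close> is positive.
    This is consistent because, by \<open>sep\<close>, no row has positive entries both inside and
    outside \<open>J\<close>.\<close>
  define t where "t i = (if \<exists>j\<in>J. q $ i $ j > 0 then 2 else 1 :: real)" for i
  have st: "t i = s j" if "q $ i $ j > 0" for i j
    using that sep unfolding s_def t_def by auto
  define x where "x = (\<chi> j. s j * f j (PPP $ j))"
  define y where "y = (\<chi> i. t i * g i (P $ i))"
  \<comment> \<open>Either the coefficient is 0 and both sides vanish, or row and column carry the
    same factor; so the scaling passes through each sum.\<close>
  have s_a: "s j * (a $ n $ j * v) = t n * v * a $ n $ j" for n j v
    using st[of n j] supp(1)[of n j] by auto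
  have "s j * f j (PPP $ j) = (\<Sum>n\<in>UNIV. t n * g n (P $ n) * a $ n $ j)" for j
    unfolding sol_eq(1)[of j] sum_distrib_left s_a ..
  then have x: "x = y v* a"
    by (simp add: x_def y_def vec_eq_iff vector_matrix_mult_def)
  have t_b: "t i * (b $ i $ m * v) = b $ i $ m * (s m * v)" for i m v
    using st[of i m] supp(2)[of i m] by auto
  have "t i * g i (P $ i) = (\<Sum>m\<in>UNIV. b $ i $ m * (s m * f m (PPP $ m)))" for i
    unfolding sol_eq(2)[of i] sum_distrib_left t_b ..
  then have y: "y = b *v x"
    by (simp add: x_def y_def vec_eq_iff matrix_vector_mult_def)
  note pos = positive_solution_pos[OF sol f g]
  have "x $ j > 0" "y $ i > 0" for i j
    using pos by (auto simp: x_def y_def s_def t_def)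
  then obtain PPP' P' where sol': "positive_solution f g a b PPP' P'"
    and x': "\<And>j. f j (PPP' $ j) = x $ j"
    using positive_solution_of_vectors[OF f g _ _ x y] by metis
  from uniq sol sol' obtain \<delta> where "\<And>j. f j (PPP' $ j) = \<delta> * f j (PPP $ j)"
    unfolding unique_positive_solution_up_to_scalar_def by blast
  \<comment> \<open>Cancelling the positive values of \<open>f\<close> turns proportionality into
    constancy of \<open>s\<close>, which takes both values 1 and 2.\<close>
  then have s: "s j = \<delta>" for j
    using x'[of j] pos(1)[of j] by (simp add: x_def)
  obtain j l where "j \<in> J" "l \<notin> J" using J by blast
  then have "s j = 2" "s l = 1" by (simp_all add: s_def)
  with s[of j] s[of l] show False by simp
qed

theorem theorem1:
  fixes q a b :: "real ^ 'm ^ 'n"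
    and f :: "'m \<Rightarrow> real \<Rightarrow> real"
    and g :: "'n \<Rightarrow> real \<Rightarrow> real"
  assumes "nonneg_matrix q"
    and "\<forall>i. \<exists>j. q $ i $ j > 0"
    and "\<forall>j. \<exists>i. q $ i $ j > 0"
    and "\<forall>j. bij_betw (f j) {0<..} {0<..}"
    and "\<forall>i. bij_betw (g i) {0<..} {0<..}"
    and "nonneg_matrix a"
    and "nonneg_matrix b"
    and "\<exists>c d :: real ^ 'm ^ 'n. nonneg_matrix c \<and> nonneg_matrix d \<and>
           (\<forall>i j. a $ i $ j = d $ i $ j / (\<Sum>n\<in>UNIV. c $ n $ j) \<and>
                  b $ i $ j = c $ i $ j / (\<Sum>m\<in>UNIV. d $ i $ m) \<and>
                  (q $ i $ j > 0 \<longleftrightarrow> d $ i $ j > 0) \<and>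
                  (q $ i $ j > 0 \<longleftrightarrow> c $ i $ j > 0))"
  shows "unique_positive_solution_up_to_scalar f g a b \<longleftrightarrow> connected_matrix q"
proof
  obtain c d :: "real ^ 'm ^ 'n" where c: "nonneg_matrix c" and d: "nonneg_matrix d"
    and a_eq: "\<And>i j. a $ i $ j = d $ i $ j / (\<Sum>n\<in>UNIV. c $ n $ j)"
    and b_eq: "\<And>i j. b $ i $ j = c $ i $ j / (\<Sum>m\<in>UNIV. d $ i $ m)"
    and qd: "\<And>i j. q $ i $ j > 0 \<longleftrightarrow> d $ i $ j > 0"
    and qc: "\<And>i j. q $ i $ j > 0 \<longleftrightarrow> c $ i $ j > 0"
    using assms(8) by blast
  note f = assms(4) and g = assms(5)
  define C where "C = (\<chi> j. \<Sum>n\<in>UNIV. c $ n $ j)"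
  define D where "D i = (\<Sum>m\<in>UNIV. d $ i $ m)" for i
  have C_pos: "C $ j > 0" for j
  proof -
    obtain i where "c $ i $ j > 0" using assms(3) qc by blast
    then show ?thesis
      using c by (auto simp: C_def nonneg_matrix_def intro: sum_pos2)
  qed
  have D_pos: "D i > 0" for i
  proof -
    obtain j where "d $ i $ j > 0" using assms(2) qd by blast
    then show ?thesis
      using d by (auto simp: D_def nonneg_matrix_def intro: sum_pos2)
  qed
  have a_def: "a $ i $ j = d $ i $ j / C $ j" and b_def: "b $ i $ j = c $ i $ j / D i" for i j
    by (simp_all add: a_eq b_eq C_def D_def)
  have a_pos: "a $ i $ j > 0 \<longleftrightarrow> q $ i $ j > 0" for i j
    using C_pos[of j] by (auto simp: a_def qd zero_less_divide_iff)
  have b_pos: "b $ i $ j > 0 \<longleftrightarrow> q $ i $ j > 0" for i j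
    using D_pos[of i] by (auto simp: b_def qc zero_less_divide_iff)
  show "connected_matrix q" if "unique_positive_solution_up_to_scalar f g a b"
  proof (rule unique_positive_solution_imp_connected[OF f g _ _ that])
    show "q $ i $ j > 0" if "a $ i $ j \<noteq> 0" for i j
      using that assms(6) a_pos by (metis nonneg_matrix_def order_le_less)
    show "q $ i $ j > 0" if "b $ i $ j \<noteq> 0" for i j
      using that assms(7) b_pos by (metis nonneg_matrix_def order_le_less)
  qed
  show "unique_positive_solution_up_to_scalar f g a b" if conn: "connected_matrix q"
  proof -
    define L where "L = transpose a ** b"
    have L_entry: "L $ j $ m = (\<Sum>n\<in>UNIV. a $ n $ j * b $ n $ m)" for j m
      by (simp add: L_def matrix_matrix_mult_def transpose_def)
    have ab: "a $ n $ j * b $ n $ m \<ge> 0" for n j m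
      using assms(6,7) by (simp add: nonneg_matrix_def)
    have L_nonneg: "nonneg_matrix L"
      using ab by (simp add: nonneg_matrix_def L_entry sum_nonneg)
    have L_irred: "irreducible_matrix L"
      unfolding irreducible_matrix_def
    proof (intro allI impI)
      fix J :: "'m set" assume "J \<noteq> {} \<and> J \<subset> UNIV"
      from conn[unfolded connected_matrix_def, rule_format, OF this]
      obtain j l k where jl: "j \<in> J" "l \<in> UNIV - J" and q: "q $ k $ j > 0" "q $ k $ l > 0"
        by blast
      \<comment> \<open>The row \<open>k\<close> linking \<open>j\<close> and \<open>l\<close>
        contributes a positive term to the entry of \<open>L\<close> at \<open>j\<close>,
        \<open>l\<close>.\<close>
      have "a $ k $ j * b $ k $ l > 0"
        using q a_pos b_pos by simp
      then have "L $ j $ l > 0"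
        unfolding L_entry by (intro sum_pos2[of _ k]) (use ab in auto)
      with jl show "\<exists>j\<in>J. \<exists>l\<in>UNIV - J. L $ j $ l > 0" by blast
    qed
    \<comment> \<open>Weighting by \<open>C\<close> cancels the denominators of \<open>a\<close> and
      leaves the row sums of \<open>d\<close>; these cancel the denominators of \<open>b\<close> and
      leave the column sums of \<open>c\<close>, which is \<open>C\<close> again.\<close>
    have "C v* transpose a = (\<chi> n. D n)"
      using C_pos by (simp add: vec_eq_iff matrix_vector_mult_def a_def D_def less_imp_neq[symmetric])
    moreover have "(\<chi> n. D n) v* b = C"
      using D_pos by (simp add: vec_eq_iff vector_matrix_mult_def b_def C_def less_imp_neq[symmetric])
    ultimately have C_fixed: "C v* L = C"
      by (simp add: L_def flip: vector_matrix_mul_assoc del: vector_transpose_matrix)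
    obtain x where x: "\<And>j. x $ j > 0" "L *v x = x"
      using irreducible_positive_fixed_vector[OF L_nonneg L_irred C_pos C_fixed] by blast
    have "(b *v x) $ i > 0" for i
    proof -
      obtain j where "q $ i $ j > 0" using assms(2) by blast
      then have "b $ i $ j * x $ j > 0" using b_pos x(1) by simp
      moreover have "b $ i $ m * x $ m \<ge> 0" for m
        using assms(7) x(1)[of m] by (simp add: nonneg_matrix_def)
      ultimately show ?thesis
        by (auto simp: matrix_vector_mult_def intro: sum_pos2)
    qed
    \<comment> \<open>With \<open>b *v x\<close> as the second unknown, the fixed-point equation of
      \<open>L\<close> is the first half of the system and the second half holds by
      reflexivity.\<close>
    moreover have "x = (b *v x) v* a"
      using x(2) by (simp add: L_def flip: matrix_vector_mul_assoc)
    ultimately have existence: "\<exists>PPP P. positive_solution f g a b PPP P"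
      using positive_solution_of_vectors[OF f g x(1) _ _ refl] by metis
    have "\<exists>\<delta>>0. (\<forall>j. f j (PPP' $ j) = \<delta> * f j (PPP $ j)) \<and> (\<forall>i. g i (P' $ i) = \<delta> * g i (P $ i))"
      if sol: "positive_solution f g a b PPP P" and sol': "positive_solution f g a b PPP' P'"
      for PPP P PPP' P'
    proof -
      let ?x = "\<chi> j. f j (PPP $ j)" and ?z = "\<chi> j. f j (PPP' $ j)"
      have fixed: "L *v ?x = ?x" "L *v ?z = ?z"
        using positive_solution_vector_form[OF sol] positive_solution_vector_form[OF sol']
        by (simp_all add: L_def flip: matrix_vector_mul_assoc)
      have "?x $ j > 0" "?z $ j > 0" for j
        using positive_solution_pos[OF sol f g] positive_solution_pos[OF sol' f g] by simp_all
      then obtain \<delta> where \<delta>: "\<delta> > 0" "?z = \<delta> *\<^sub>R ?x"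
        using irreducible_fixed_vector_unique[OF L_nonneg L_irred _ fixed(1) _ fixed(2)] by blast
      \<comment> \<open>The values of \<open>g\<close> are the image under \<open>b\<close> of those
        of \<open>f\<close>, so they inherit the same factor.\<close>
      have "(\<chi> i. g i (P' $ i)) = \<delta> *\<^sub>R (\<chi> i. g i (P $ i))"
        using positive_solution_vector_form(2)[OF sol] positive_solution_vector_form(2)[OF sol'] \<delta>(2)
        by (simp add: matrix_vector_mult_scaleR)
      with \<delta> show ?thesis by (auto simp: vec_eq_iff)
    qed
    with existence show ?thesis
      unfolding unique_positive_solution_up_to_scalar_def by blast
  qed
qed

end
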